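(* Let $(V,b,m)$ be an infinite, locally finite, connected graph over a non-Archimedean ordered field $\mathbb K$ which is Cauchy complete and has countable cofinality. Let $a\in V$ be a fixed vertex and let $(K_n)_{n\ge0}$ be an exhaustion of $V$ by finite connected sets with $a\in K_0$. Let $v_n$ be the solution of the Dirichlet problem for $K_n$ and $a$. Then $$\mathrm{cap}(a)=m(a)\lim_{n\to\infty}\Delta v_n(a)=b(a)-\lim_{n\to\infty}\sum_{y\in V}v_n(y)b(a,y)$$ in case either limit exists. Moreover: (1) $\mathrm{cap}(a)=0$ if and only if $\lim_{n\to\infty}v_n(x)=1$ for all $x\in V$. (2) $\mathrm{cap}(a)$ exists and $\mathrm{cap}(a)\succ0$ if and only if $\lim_{n\to\infty}v_n(x)$ exists for all $x\in V$ and $\lim_{n\to\infty}v_n(x)\prec1$ for some $x\in V$. (3) $\mathrm{cap}(a)$ does not exist if and only if $\lim_{n\to\infty}v_n(x)$ does not exist for some $x\in V$.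
   Context: An ordered field $(\mathbb K,\succ)$ is non-Archimedean if there is $\tau\succ0$ with $\tau\prec 1/n$ for all $n\in\mathbb N$. $\mathbb K^+=\{k\in\mathbb K: k\succ0\}$. A sequence $(k_n)$ converges to $k\in\mathbb K$ if for every $c\in\mathbb K^+$ one has $|k_n-k|\preceq c$ for all large $n$; here limits are limits in $\mathbb K$. Cauchy complete: every Cauchy sequence converges. Countable cofinality: there is a countable $S\subset\mathbb K$ such that every $k\in\mathbb K$ satisfies $k\preceq s$ for some $s\in S$. A graph $(V,b,m)$ over $\mathbb K$: $V$ is an at most countable set, $m:V\to\mathbb K^+$, and $b:V\times V\to\mathbb K^+\cup\{0\}$ is symmetric with $b(x,x)=0$. Write $x\sim y$ if $b(x,y)\neq0$; locally finite means each vertex has finitely many neighbors; connectedness (of $V$, or of a subset $K$ via paths inside $K$) is with respect to paths $x_0\sim x_1\sim\dots\sim x_n$, and $d$ is the combinatorial graph distance. $B_n(a)=\{x\in V: d(a,x)<n\}$ and $b(x)=\sum_{y\in V}b(x,y)$. Laplacian: $\Delta f(x)=\frac1{m(x)}\sum_{y\in V}(f(x)-f(y))b(x,y)$ for $f:V\to\mathbb K$. Dirichlet problem: for a finite connected $K\subseteq V$ and $a\in K$ there is a unique $v:V\to\mathbb K$ with $\Delta v=0$ on $K\setminus\{a\}$, $v(a)=1$, $v=0$ on $V\setminus K$; put $\mathrm{cap}_K(a)=\Delta v(a)m(a)$ and $\mathrm{cap}_n(a)=\mathrm{cap}_{B_n(a)}(a)$, $n\ge1$. The effective capacity is $\mathrm{cap}(a)=\lim_{n\to\infty}\mathrm{cap}_n(a)$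 if this limit exists in $\mathbb K$. An exhaustion is a sequence of finite sets $K_n\subset V$ with $K_n\subset K_{n+1}$ for all $n\ge 0$ and $V=\bigcup_n K_n$. *)

theory Defs
  imports Main "HOL-Library.Countable_Set" "HOL-Library.FuncSet"
begin

definition non_archimedean :: "'k::linordered_field itself \<Rightarrow> bool" where
  "non_archimedean (T :: 'k itself) \<longleftrightarrow>
     (\<exists>\<tau>::'k. \<tau> > 0 \<and> (\<forall>n::nat. n \<ge> 1 \<longrightarrow> \<tau> < 1 / of_nat n))"

text \<open>No topology is put on the field: convergence and Cauchy sequences are measured by
  arbitrary positive field elements, so limits are limits in the field itself.\<close>

definition converges_to :: "(nat \<Rightarrow> 'k::linordered_field) \<Rightarrow> 'k \<Rightarrow> bool" where
  "converges_to s l \<longleftrightarrow> (\<forall>c>0. \<exists>N. \<forall>n\<ge>N. \<bar>s n - l\<bar> \<le> c)"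

definition has_limit :: "(nat \<Rightarrow> 'k::linordered_field) \<Rightarrow> bool" where
  "has_limit s \<longleftrightarrow> (\<exists>l. converges_to s l)"

definition cauchy_seq :: "(nat \<Rightarrow> 'k::linordered_field) \<Rightarrow> bool" where
  "cauchy_seq s \<longleftrightarrow> (\<forall>c>0. \<exists>N. \<forall>n\<ge>N. \<forall>p\<ge>N. \<bar>s n - s p\<bar> \<le> c)"

definition cauchy_complete :: "'k::linordered_field itself \<Rightarrow> bool" where
  "cauchy_complete (T :: 'k itself) \<longleftrightarrow>
     (\<forall>s::nat \<Rightarrow> 'k. cauchy_seq s \<longrightarrow> has_limit s)"

definition countable_cofinality :: "'k::linordered_field itself \<Rightarrow> bool" where
  "countable_cofinality (T :: 'k itself) \<longleftrightarrow>
     (\<exists>S::'k set. countable S \<and> (\<forall>k. \<exists>s\<in>S. k \<le> s))"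

text \<open>The vertex set is the carrier \<open>V\<close>; values of \<open>b\<close> and \<open>m\<close> outside it are irrelevant.\<close>

definition graph_over ::
  "'v set \<Rightarrow> ('v \<Rightarrow> 'v \<Rightarrow> 'k::linordered_field) \<Rightarrow> ('v \<Rightarrow> 'k) \<Rightarrow> bool" where
  "graph_over V b m \<longleftrightarrow>
     countable V \<and>
     (\<forall>x\<in>V. m x > 0) \<and>
     (\<forall>x\<in>V. \<forall>y\<in>V. b x y \<ge> 0) \<and>
     (\<forall>x\<in>V. \<forall>y\<in>V. b x y = b y x) \<and>
     (\<forall>x\<in>V. b x x = 0)"

definition edges :: "'v set \<Rightarrow> ('v \<Rightarrow> 'v \<Rightarrow> 'k::linordered_field) \<Rightarrow> ('v \<times> 'v) set" where
  "edges V b = {(x, y). x \<in> V \<and> y \<in> V \<and> b x y \<noteq> 0}"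

definition nbrs :: "'v set \<Rightarrow> ('v \<Rightarrow> 'v \<Rightarrow> 'k::linordered_field) \<Rightarrow> 'v \<Rightarrow> 'v set" where
  "nbrs V b x = {y \<in> V. b x y \<noteq> 0}"

definition locally_finite :: "'v set \<Rightarrow> ('v \<Rightarrow> 'v \<Rightarrow> 'k::linordered_field) \<Rightarrow> bool" where
  "locally_finite V b \<longleftrightarrow> (\<forall>x\<in>V. finite (nbrs V b x))"

text \<open>Any two vertices of \<open>K\<close> are joined by a path all of whose vertices lie in \<open>K\<close>;
  paths of length zero are allowed.\<close>

definition connected_in :: "('v \<Rightarrow> 'v \<Rightarrow> 'k::linordered_field) \<Rightarrow> 'v set \<Rightarrow> bool" where
  "connected_in b K \<longleftrightarrow> (\<forall>x\<in>K. \<forall>y\<in>K. (x, y) \<in> (edges K b)\<^sup>*)"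

text \<open>Minimal length of a path; meaningful only for vertices joined by some path.\<close>

definition graph_dist ::
  "'v set \<Rightarrow> ('v \<Rightarrow> 'v \<Rightarrow> 'k::linordered_field) \<Rightarrow> 'v \<Rightarrow> 'v \<Rightarrow> nat" where
  "graph_dist V b x y = (LEAST n. (x, y) \<in> edges V b ^^ n)"

definition graph_ball ::
  "'v set \<Rightarrow> ('v \<Rightarrow> 'v \<Rightarrow> 'k::linordered_field) \<Rightarrow> nat \<Rightarrow> 'v \<Rightarrow> 'v set" where
  "graph_ball V b n a = {x \<in> V. graph_dist V b a x < n}"

text \<open>Sums over all of \<open>V\<close> whose terms carry a factor \<open>b x y\<close> are written as sums over the
  neighbours of \<open>x\<close>, a finite set by local finiteness; \<^term>\<open>sum f V\<close> would be \<open>0\<close>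
  for infinite \<open>V\<close>.\<close>

definition weighted_degree ::
  "'v set \<Rightarrow> ('v \<Rightarrow> 'v \<Rightarrow> 'k::linordered_field) \<Rightarrow> 'v \<Rightarrow> 'k" where
  "weighted_degree V b x = (\<Sum>y\<in>nbrs V b x. b x y)"

definition laplacian ::
  "'v set \<Rightarrow> ('v \<Rightarrow> 'v \<Rightarrow> 'k::linordered_field) \<Rightarrow> ('v \<Rightarrow> 'k) \<Rightarrow> ('v \<Rightarrow> 'k) \<Rightarrow> 'v \<Rightarrow> 'k" where
  "laplacian V b m f x = 1 / m x * (\<Sum>y\<in>nbrs V b x. (f x - f y) * b x y)"

text \<open>Functions on \<open>V\<close> are taken extensional, so that uniqueness of the solution is
  equality of functions and the definite description below is justified.\<close>

definition solves_dirichlet ::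
  "'v set \<Rightarrow> ('v \<Rightarrow> 'v \<Rightarrow> 'k::linordered_field) \<Rightarrow> ('v \<Rightarrow> 'k) \<Rightarrow> 'v set \<Rightarrow> 'v \<Rightarrow> ('v \<Rightarrow> 'k) \<Rightarrow> bool"
  where
  "solves_dirichlet V b m K a v \<longleftrightarrow>
     v \<in> extensional V \<and>
     (\<forall>x\<in>K - {a}. laplacian V b m v x = 0) \<and>
     v a = 1 \<and>
     (\<forall>x\<in>V - K. v x = 0)"

definition dirichlet_solution ::
  "'v set \<Rightarrow> ('v \<Rightarrow> 'v \<Rightarrow> 'k::linordered_field) \<Rightarrow> ('v \<Rightarrow> 'k) \<Rightarrow> 'v set \<Rightarrow> 'v \<Rightarrow> ('v \<Rightarrow> 'k)" where
  "dirichlet_solution V b m K a = (THE v. solves_dirichlet V b m K a v)"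

definition cap_on ::
  "'v set \<Rightarrow> ('v \<Rightarrow> 'v \<Rightarrow> 'k::linordered_field) \<Rightarrow> ('v \<Rightarrow> 'k) \<Rightarrow> 'v set \<Rightarrow> 'v \<Rightarrow> 'k" where
  "cap_on V b m K a = laplacian V b m (dirichlet_solution V b m K a) a * m a"

text \<open>Intended for \<open>n \<ge> 1\<close> only: for \<open>n = 0\<close> the ball is empty and the value is arbitrary,
  which does not affect limits.\<close>

definition cap_ball ::
  "'v set \<Rightarrow> ('v \<Rightarrow> 'v \<Rightarrow> 'k::linordered_field) \<Rightarrow> ('v \<Rightarrow> 'k) \<Rightarrow> nat \<Rightarrow> 'v \<Rightarrow> 'k" where
  "cap_ball V b m n a = cap_on V b m (graph_ball V b n a) a"

text \<open>The effective capacity is a partial notion; \<open>has_capacity V b m a c\<close> says that it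
  exists and equals \<open>c\<close>.\<close>

definition has_capacity ::
  "'v set \<Rightarrow> ('v \<Rightarrow> 'v \<Rightarrow> 'k::linordered_field) \<Rightarrow> ('v \<Rightarrow> 'k) \<Rightarrow> 'v \<Rightarrow> 'k \<Rightarrow> bool" where
  "has_capacity V b m a c \<longleftrightarrow> converges_to (\<lambda>n. cap_ball V b m n a) c"

definition exhaustion :: "'v set \<Rightarrow> (nat \<Rightarrow> 'v set) \<Rightarrow> bool" where
  "exhaustion V K \<longleftrightarrow>
     (\<forall>n. finite (K n) \<and> K n \<subseteq> V) \<and> (\<forall>n. K n \<subseteq> K (Suc n)) \<and> V = (\<Union>n. K n)"

end

theory Submission imports Defs
begin

text \<open>For nonnegative \<open>w\<close> with \<open>w a = 0\<close> that is harmonic on a sufficiently large finite set outside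
  \<open>a\<close>, each value \<open>w x\<close> is at most a constant (depending only on \<open>x\<close>) times the flux
  \<open>\<Sum>y. w y * b a y\<close> into \<open>a\<close>: this follows along a path from \<open>a\<close> to \<open>x\<close>, as harmonicity bounds the
  value at a neighbour by the value at the vertex. By the minimum principle it applies to
  \<open>w = v p - v n\<close>, whose flux is the difference of two capacities, and to \<open>w = 1 - v n\<close>, whose flux
  is a capacity. So the capacities form a Cauchy sequence iff all the sequences \<open>v n x\<close> do, and they tend
  to \<open>0\<close> iff all \<open>v n x\<close> tend to \<open>1\<close>. Capacities decrease in the finite set, so that the balls may
  be replaced by any exhaustion.\<close>

section \<open>Limits in an ordered field\<close>

lemma converges_to_unique:
  assumes "converges_to s l" "converges_to s l'"
  shows "l = l'"
proof (rule ccontr)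
  assume "l \<noteq> l'"
  \<comment> \<open>A quarter of the distance, because convergence is measured with a non-strict
    bound: two tolerances must add up to strictly less than the distance.\<close>
  define c where "c = \<bar>l - l'\<bar> / 4"
  have c: "c > 0" using \<open>l \<noteq> l'\<close> by (simp add: c_def)
  obtain N where N: "\<forall>n\<ge>N. \<bar>s n - l\<bar> \<le> c" using assms(1) c unfolding converges_to_def by blast
  obtain N' where N': "\<forall>n\<ge>N'. \<bar>s n - l'\<bar> \<le> c" using assms(2) c unfolding converges_to_def by blast
  let ?n = "max N N'"
  have "\<bar>l - l'\<bar> \<le> \<bar>s ?n - l\<bar> + \<bar>s ?n - l'\<bar>" by linarith
  also have "\<dots> \<le> c + c" using N N' by (intro add_mono) auto
  also have "\<dots> = \<bar>l - l'\<bar> / 2" by (simp add: c_def)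
  finally show False using \<open>l \<noteq> l'\<close> by simp
qed

lemma converges_to_const: "converges_to (\<lambda>_. k) k"
  by (simp add: converges_to_def)

lemma converges_to_squeeze:
  assumes "converges_to t 0" and "\<And>n. n \<ge> N \<Longrightarrow> \<bar>s n - l\<bar> \<le> t n"
  shows "converges_to s l"
  unfolding converges_to_def
proof (intro allI impI)
  fix c :: 'a assume "c > 0"
  then obtain M where M: "\<forall>n\<ge>M. \<bar>t n - 0\<bar> \<le> c" using assms(1) unfolding converges_to_def by blast
  have "\<bar>s n - l\<bar> \<le> c" if "n \<ge> max N M" for n
  proof -
    have "\<bar>s n - l\<bar> \<le> t n" using assms(2) that by simp
    also have "\<dots> \<le> \<bar>t n - 0\<bar>" by simp
    also have "\<dots> \<le> c" using M that by simp
    finally show ?thesis .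
  qed
  then show "\<exists>N. \<forall>n\<ge>N. \<bar>s n - l\<bar> \<le> c" by blast
qed

lemma converges_to_cmult:
  assumes "converges_to s l"
  shows "converges_to (\<lambda>n. k * s n) (k * l)"
proof (cases "k = 0")
  case True
  then show ?thesis by (simp add: converges_to_const)
next
  case False
  show ?thesis
    unfolding converges_to_def
  proof (intro allI impI)
    fix c :: 'a assume "c > 0"
    then have "c / \<bar>k\<bar> > 0" using False by simp
    then obtain N where N: "\<forall>n\<ge>N. \<bar>s n - l\<bar> \<le> c / \<bar>k\<bar>"
      using assms unfolding converges_to_def by blast
    have "\<bar>k * s n - k * l\<bar> \<le> c" if "n \<ge> N" for n
    proof -
      have "\<bar>k * s n - k * l\<bar> = \<bar>k\<bar> * \<bar>s n - l\<bar>"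
        by (simp add: abs_mult flip: right_diff_distrib)
      also have "\<dots> \<le> c" using N that False by (simp add: pos_le_divide_eq mult.commute)
      finally show ?thesis .
    qed
    then show "\<exists>N. \<forall>n\<ge>N. \<bar>k * s n - k * l\<bar> \<le> c" by blast
  qed
qed

lemma converges_to_add:
  assumes "converges_to s l" "converges_to t k"
  shows "converges_to (\<lambda>n. s n + t n) (l + k)"
  unfolding converges_to_def
proof (intro allI impI)
  fix c :: 'a assume "c > 0"
  then have "c / 2 > 0" by simp
  obtain N where N: "\<forall>n\<ge>N. \<bar>s n - l\<bar> \<le> c / 2"
    using assms(1) \<open>c / 2 > 0\<close> unfolding converges_to_def by blast
  obtain M where M: "\<forall>n\<ge>M. \<bar>t n - k\<bar> \<le> c / 2"
    using assms(2) \<open>c / 2 > 0\<close> unfolding converges_to_def by blast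
  have "\<bar>s n + t n - (l + k)\<bar> \<le> c" if "n \<ge> max N M" for n
  proof -
    have "\<bar>s n + t n - (l + k)\<bar> \<le> \<bar>s n - l\<bar> + \<bar>t n - k\<bar>" by linarith
    also have "\<dots> \<le> c / 2 + c / 2" using N M that by (intro add_mono) auto
    finally show ?thesis by simp
  qed
  then show "\<exists>N. \<forall>n\<ge>N. \<bar>s n + t n - (l + k)\<bar> \<le> c" by blast
qed

lemma converges_to_const_diff:
  assumes "converges_to s l"
  shows "converges_to (\<lambda>n. k - s n) (k - l)"
  using converges_to_add[OF converges_to_const converges_to_cmult[OF assms, of "-1"], of k] by simp

lemma converges_to_sum:
  assumes "\<And>i. i \<in> I \<Longrightarrow> converges_to (\<lambda>n. f n i) (l i)"
  shows "converges_to (\<lambda>n. sum (f n) I) (sum l I)"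
  using assms
  \<comment> \<open>For infinite \<open>I\<close> both sums are 0 by convention, so that case is a
    constant sequence.\<close>
  by (induction I rule: infinite_finite_induct) (auto simp: converges_to_const intro!: converges_to_add)

lemma converges_to_nonneg:
  assumes "converges_to s l" and "\<And>n. s n \<ge> 0"
  shows "l \<ge> 0"
proof (rule ccontr)
  assume "\<not> l \<ge> 0"
  then have "- l / 2 > 0" by simp
  then obtain N where "\<bar>s N - l\<bar> \<le> - l / 2" using assms(1) unfolding converges_to_def by blast
  moreover have "s N \<ge> 0" by (rule assms(2))
  ultimately show False using \<open>\<not> l \<ge> 0\<close> by linarith
qed

text \<open>Serves to discard the empty ball of radius 0 from the sequence defining the
  capacity.\<close>

lemma converges_to_Suc_iff: "converges_to (\<lambda>n. s (Suc n)) l \<longleftrightarrow> converges_to s l"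
proof
  assume *: "converges_to (\<lambda>n. s (Suc n)) l"
  show "converges_to s l"
    unfolding converges_to_def
  proof (intro allI impI)
    fix c :: 'a assume "c > 0"
    then obtain N where "\<forall>n\<ge>N. \<bar>s (Suc n) - l\<bar> \<le> c" using * unfolding converges_to_def by blast
    then have "\<forall>n\<ge>Suc N. \<bar>s n - l\<bar> \<le> c" by (metis Suc_le_D Suc_le_mono)
    then show "\<exists>N. \<forall>n\<ge>N. \<bar>s n - l\<bar> \<le> c" by blast
  qed
next
  assume "converges_to s l"
  then show "converges_to (\<lambda>n. s (Suc n)) l" unfolding converges_to_def by (meson le_SucI)
qed

lemma converges_to_decseq_le:
  assumes "converges_to s l" and "\<And>n p. n \<le> p \<Longrightarrow> s p \<le> s n"
  shows "l \<le> s n"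
proof (rule ccontr)
  assume "\<not> l \<le> s n"
  then have "(l - s n) / 2 > 0" by simp
  then obtain N where "\<forall>q\<ge>N. \<bar>s q - l\<bar> \<le> (l - s n) / 2"
    using assms(1) unfolding converges_to_def by blast
  then have "\<bar>s (max n N) - l\<bar> \<le> (l - s n) / 2" by simp
  moreover have "s (max n N) \<le> s n" by (rule assms(2)) simp
  ultimately show False using \<open>\<not> l \<le> s n\<close> by (simp add: field_simps abs_if split: if_splits)
qed

text \<open>Below, \<open>t n\<close> dominates some \<open>s q\<close> and hence \<open>l\<close>;
  above, from some index on it stays under a term of \<open>s\<close> close to
  \<open>l\<close>.\<close>

lemma converges_to_interleaved:
  assumes s: "converges_to s l"
    and sdec: "\<And>n p. n \<le> p \<Longrightarrow> s p \<le> s n" and tdec: "\<And>n p. n \<le> p \<Longrightarrow> t p \<le> t n"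
    and st: "\<And>n. \<exists>p. s p \<le> t n" and ts: "\<And>n. \<exists>p. t p \<le> s n"
  shows "converges_to t l"
  unfolding converges_to_def
proof (intro allI impI)
  fix c :: 'a assume "c > 0"
  then obtain N where N: "\<forall>n\<ge>N. \<bar>s n - l\<bar> \<le> c" using s unfolding converges_to_def by blast
  obtain M where M: "t M \<le> s N" using ts by blast
  have "\<bar>t n - l\<bar> \<le> c" if "n \<ge> M" for n
  proof -
    obtain q where "s q \<le> t n" using st by blast
    moreover have "l \<le> s q" by (rule converges_to_decseq_le[OF s sdec])
    moreover have "t n \<le> t M" using tdec that by simp
    moreover have "\<bar>s N - l\<bar> \<le> c" using N by simp
    ultimately show ?thesis using M by linarith
  qed
  then show "\<exists>N. \<forall>n\<ge>N. \<bar>t n - l\<bar> \<le> c" by blast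
qed

text \<open>The convergent sequence \<open>r\<close> is Cauchy, and its differences control those of
  \<open>s\<close>. Completeness then supplies the limit; in a non-Archimedean field boundedness and
  monotonicity would not.\<close>

lemma has_limit_dominated:
  assumes "cauchy_complete TYPE('k::linordered_field)"
    and "has_limit (r :: nat \<Rightarrow> 'k)"
    and "\<And>n p. N \<le> n \<Longrightarrow> n \<le> p \<Longrightarrow> \<bar>s p - s n\<bar> \<le> C * (r n - r p)"
    and "C > 0"
  shows "has_limit (s :: nat \<Rightarrow> 'k)"
proof -
  obtain l where l: "converges_to r l" using assms(2) unfolding has_limit_def by blast
  have "cauchy_seq s"
    unfolding cauchy_seq_def
  proof (intro allI impI)
    fix c :: 'k assume "c > 0"
    \<comment> \<open>One half for each of \<open>r n\<close> and \<open>r p\<close>, divided by the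
      factor \<open>C\<close> that multiplies their difference.\<close>
    then have "c / C / 2 > 0" using assms(4) by simp
    then obtain M where M: "\<And>n. n \<ge> M \<Longrightarrow> \<bar>r n - l\<bar> \<le> c / C / 2"
      using l unfolding converges_to_def by blast
    have *: "\<bar>s p - s n\<bar> \<le> c" if "n \<ge> max M N" "n \<le> p" for n p
    proof -
      have "\<bar>s p - s n\<bar> \<le> C * (r n - r p)" using assms(3) that by simp
      also have "\<dots> \<le> C * (c / C / 2 + c / C / 2)"
      proof (rule mult_left_mono)
        have "\<bar>r n - l\<bar> \<le> c / C / 2" "\<bar>r p - l\<bar> \<le> c / C / 2" using M that by auto
        then have "r n - l \<le> c / C / 2" "l - r p \<le> c / C / 2" by (simp_all add: abs_le_iff)
        from add_mono[OF this] show "r n - r p \<le> c / C / 2 + c / C / 2" by simp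
      qed (use assms(4) in simp)
      also have "\<dots> = c" using assms(4) by simp
      finally show ?thesis .
    qed
    have "\<bar>s n - s p\<bar> \<le> c" if "n \<ge> max M N" "p \<ge> max M N" for n p
      using *[of n p] *[of p n] that by (cases "n \<le> p") (auto simp: abs_minus_commute)
    then show "\<exists>N. \<forall>n\<ge>N. \<forall>p\<ge>N. \<bar>s n - s p\<bar> \<le> c" by blast
  qed
  then show ?thesis using assms(1) unfolding cauchy_complete_def by blast
qed

section \<open>The Dirichlet problem\<close>

text \<open>The Laplacian freed of the factor 1 / \<open>m x\<close>. For positive masses it has the
  same zeros, and for a Dirichlet solution its value at \<open>a\<close> is the capacity.\<close>

definition flux ::
  "'v set \<Rightarrow> ('v \<Rightarrow> 'v \<Rightarrow> 'k::linordered_field) \<Rightarrow> ('v \<Rightarrow> 'k) \<Rightarrow> 'v \<Rightarrow> 'k" where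
  "flux V b f x = (\<Sum>y\<in>nbrs V b x. (f x - f y) * b x y)"

lemma laplacian_flux: "laplacian V b m f x = flux V b f x / m x"
  by (simp add: laplacian_def flux_def)

lemma flux_add: "flux V b (\<lambda>x. f x + g x) x = flux V b f x + flux V b g x"
  unfolding flux_def sum.distrib[symmetric] by (intro sum.cong) (auto simp: algebra_simps)

lemma flux_cmult: "flux V b (\<lambda>x. k * f x) x = k * flux V b f x"
  unfolding flux_def sum_distrib_left by (intro sum.cong) (auto simp: algebra_simps)

lemma flux_diff: "flux V b (\<lambda>x. f x - g x) x = flux V b f x - flux V b g x"
  unfolding flux_def sum_subtractf[symmetric] by (intro sum.cong) (auto simp: algebra_simps)

lemma flux_const: "flux V b (\<lambda>_. k) x = 0"
  by (simp add: flux_def)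

lemma flux_cong:
  assumes "\<And>y. y \<in> V \<Longrightarrow> f y = g y" and "x \<in> V"
  shows "flux V b f x = flux V b g x"
  unfolding flux_def using assms by (intro sum.cong) (auto simp: nbrs_def)

lemma flux_conv_degree:
  "flux V b f x = f x * weighted_degree V b x - (\<Sum>y\<in>nbrs V b x. f y * b x y)"
  by (simp add: flux_def weighted_degree_def left_diff_distrib sum_subtractf sum_distrib_left)

section \<open>Minimum principle, uniqueness and existence of harmonic extensions\<close>

locale infinite_graph =
  fixes V :: "'v set" and b :: "'v \<Rightarrow> 'v \<Rightarrow> 'k::linordered_field"
  assumes finite_nbrs: "x \<in> V \<Longrightarrow> finite (nbrs V b x)"
    and weight_nonneg: "x \<in> V \<Longrightarrow> y \<in> V \<Longrightarrow> b x y \<ge> 0"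
    and connected: "connected_in b V"
    and infinite_V: "infinite V"
begin

text \<open>A negative value would make the minimum over \<open>F\<close> a minimum over all of
  \<open>V\<close>. At such a vertex nonnegative flux forces every neighbour to have the same value,
  and connectedness carries this value out of \<open>F\<close>, where \<open>f\<close> is
  nonnegative.\<close>

lemma minimum_principle:
  assumes F: "finite F" "F \<subseteq> V"
    and super: "\<And>x. x \<in> F \<Longrightarrow> flux V b f x \<ge> 0"
    and bdry: "\<And>x. x \<in> V - F \<Longrightarrow> f x \<ge> 0"
    and x: "x \<in> V"
  shows "f x \<ge> 0"
proof (rule ccontr)
  assume neg: "\<not> f x \<ge> 0"
  then have "x \<in> F" using bdry x by blast
  then have Fne: "F \<noteq> {}" by blast
  define z where "z = arg_min_on f F"
  have zF: "z \<in> F" and zmin: "\<And>y. y \<in> F \<Longrightarrow> f z \<le> f y"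
    unfolding z_def using F(1) Fne by (auto intro: arg_min_if_finite arg_min_least)
  have zneg: "f z < 0" using zmin[OF \<open>x \<in> F\<close>] neg by simp
  have zglob: "f z \<le> f y" if "y \<in> V" for y
    using zmin[of y] bdry[of y] that zneg by force
  have const: "f y = f z" if "(z, y) \<in> (edges V b)\<^sup>*" for y
    using that
  proof (induction rule: rtrancl_induct)
    case (step y w)
    from step.hyps(2) have yV: "y \<in> V" and w: "w \<in> nbrs V b y"
      by (auto simp: edges_def nbrs_def)
    \<comment> \<open>The value at \<open>y\<close> is still the negative minimum, so the path has
      not left \<open>F\<close> and the flux condition is available.\<close>
    have "y \<in> F" using step.IH zneg bdry[of y] yV by force
    have terms: "(f u - f y) * b y u \<ge> 0" if "u \<in> nbrs V b y" for u
      using zglob[of u] step.IH weight_nonneg[OF yV, of u] that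
      by (intro mult_nonneg_nonneg) (auto simp: nbrs_def)
    have "(\<Sum>u\<in>nbrs V b y. (f u - f y) * b y u) = - flux V b f y"
      unfolding flux_def sum_negf[symmetric] by (intro sum.cong) (auto simp: algebra_simps)
    then have "(\<Sum>u\<in>nbrs V b y. (f u - f y) * b y u) \<le> 0"
      using super[OF \<open>y \<in> F\<close>] by simp
    moreover have "(\<Sum>u\<in>nbrs V b y. (f u - f y) * b y u) \<ge> 0"
      by (rule sum_nonneg) (rule terms)
    ultimately have "(\<Sum>u\<in>nbrs V b y. (f u - f y) * b y u) = 0"
      by (rule antisym)
    then have "(f w - f y) * b y w = 0"
      using sum_nonneg_eq_0_iff[of "nbrs V b y" "\<lambda>u. (f u - f y) * b y u"] finite_nbrs[OF yV] terms w
      by blast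
    then show ?case using w step.IH by (auto simp: nbrs_def)
  qed simp
  \<comment> \<open>A vertex outside the finite set \<open>F\<close> exists because \<open>V\<close>
    is infinite.\<close>
  obtain u where u: "u \<in> V - F"
    using F infinite_V by (metis finite_subset subsetI Diff_iff)
  then have "f u = f z"
    using const connected zF F(2) unfolding connected_in_def by blast
  then show False using bdry[OF u] zneg by simp
qed

text \<open>The minimum principle applies to both differences: their fluxes vanish on
  \<open>F\<close>, and they vanish themselves off \<open>F\<close>.\<close>

lemma harmonic_unique:
  assumes F: "finite F" "F \<subseteq> V"
    and "\<And>x. x \<in> F \<Longrightarrow> flux V b f x = flux V b g x"
    and "\<And>x. x \<in> V - F \<Longrightarrow> f x = g x"
    and "x \<in> V"
  shows "f x = g x"
proof -
  have "f x - g x \<ge> 0" "g x - f x \<ge> 0"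
    using minimum_principle[OF F, of "\<lambda>x. f x - g x" x] minimum_principle[OF F, of "\<lambda>x. g x - f x" x]
      assms by (auto simp: flux_diff)
  then show ?thesis by simp
qed

text \<open>Adding the vertex \<open>z\<close> to \<open>F\<close>, one corrects the solution on \<open>F\<close> by a multiple of the solution
  with boundary value \<open>1\<close> at \<open>z\<close> and \<open>0\<close> elsewhere. By uniqueness the latter is not
  harmonic at \<open>z\<close>.\<close>

lemma harmonic_extension_exists:
  assumes "finite F" "F \<subseteq> V"
  shows "\<exists>f. (\<forall>x\<in>F. flux V b f x = 0) \<and> (\<forall>x\<in>V - F. f x = g x)"
  using assms
proof (induction F arbitrary: g rule: finite_induct)
  case empty
  then show ?case by blast
next
  case (insert z F)
  then have F: "F \<subseteq> V" and z: "z \<in> V" "z \<notin> F" by auto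
  obtain f where f: "\<forall>x\<in>F. flux V b f x = 0" "\<forall>x\<in>V - F. f x = g x"
    using insert.IH[OF F] by blast
  obtain h where h: "\<forall>x\<in>F. flux V b h x = 0" "\<forall>x\<in>V - F. h x = (if x = z then 1 else 0)"
    using insert.IH[OF F, of "\<lambda>x. if x = z then 1 else 0"] by blast
  have hz: "flux V b h z \<noteq> 0"
  proof
    assume "flux V b h z = 0"
    then have "h z = 0"
      using harmonic_unique[of "insert z F" h "\<lambda>_. 0" z] h insert.hyps(1) F z
      by (auto simp: flux_const)
    then show False using h(2) z by simp
  qed
  define t where "t = - flux V b f z / flux V b h z"
  have "\<forall>x\<in>insert z F. flux V b (\<lambda>x. f x + t * h x) x = 0"
    unfolding flux_add flux_cmult using f(1) h(1) hz by (auto simp: t_def)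
  moreover have "\<forall>x\<in>V - insert z F. f x + t * h x = g x"
    using f(2) h(2) by simp
  ultimately show ?case by blast
qed

end

section \<open>Dirichlet solutions and capacities of finite sets\<close>

locale weighted_infinite_graph = infinite_graph V b
  for V :: "'v set" and b :: "'v \<Rightarrow> 'v \<Rightarrow> 'k::linordered_field" +
  fixes m :: "'v \<Rightarrow> 'k" and a :: 'v
  assumes mass_pos: "x \<in> V \<Longrightarrow> m x > 0"
    and root: "a \<in> V"
begin

lemma laplacian_eq_0_iff: "x \<in> V \<Longrightarrow> laplacian V b m f x = 0 \<longleftrightarrow> flux V b f x = 0"
  using mass_pos[of x] by (simp add: laplacian_flux)

text \<open>A solution is a harmonic extension to \<open>K - {a}\<close> of the function that is 1
  at \<open>a\<close> and 0 elsewhere, so \<open>a\<close> counts as boundary. Restriction to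
  \<open>V\<close> makes it extensional without changing the flux, which only reads values in
  \<open>V\<close>.\<close>

lemma solves_dirichlet_ex1:
  assumes K: "finite K" "K \<subseteq> V" "a \<in> K"
  shows "\<exists>!v. solves_dirichlet V b m K a v"
proof (rule ex_ex1I)
  obtain f where f: "\<forall>x\<in>K - {a}. flux V b f x = 0"
    "\<forall>x\<in>V - (K - {a}). f x = (if x = a then 1 else 0)"
    using harmonic_extension_exists[of "K - {a}" "\<lambda>x. if x = a then 1 else 0"] K by auto
  have "flux V b (restrict f V) x = flux V b f x" if "x \<in> V" for x
    using that by (intro flux_cong) auto
  then have "solves_dirichlet V b m K a (restrict f V)"
    using f K root unfolding solves_dirichlet_def by (auto simp: laplacian_eq_0_iff subset_iff)
  then show "\<exists>v. solves_dirichlet V b m K a v" by blast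
next
  fix v w
  assume v: "solves_dirichlet V b m K a v" and w: "solves_dirichlet V b m K a w"
  show "v = w"
  proof (rule extensionalityI)
    show "v \<in> extensional V" "w \<in> extensional V"
      using v w by (auto simp: solves_dirichlet_def)
    show "v x = w x" if "x \<in> V" for x
    proof (rule harmonic_unique[of "K - {a}"])
      fix x assume "x \<in> K - {a}"
      then show "flux V b v x = flux V b w x"
        using v w K by (auto simp: solves_dirichlet_def laplacian_eq_0_iff subset_iff)
    next
      fix x assume "x \<in> V - (K - {a})"
      then show "v x = w x"
        using v w by (cases "x = a") (auto simp: solves_dirichlet_def)
    qed (use K that in auto)
  qed
qed

abbreviation "sol K \<equiv> dirichlet_solution V b m K a"

lemma
  assumes K: "finite K" "K \<subseteq> V" "a \<in> K"
  shows sol_harmonic: "x \<in> K \<Longrightarrow> x \<noteq> a \<Longrightarrow> flux V b (sol K) x = 0"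
    and sol_root: "sol K a = 1"
    and sol_outside: "x \<in> V \<Longrightarrow> x \<notin> K \<Longrightarrow> sol K x = 0"
proof -
  have "solves_dirichlet V b m K a (sol K)"
    unfolding dirichlet_solution_def by (rule theI'[OF solves_dirichlet_ex1[OF K]])
  then show "x \<in> K \<Longrightarrow> x \<noteq> a \<Longrightarrow> flux V b (sol K) x = 0" "sol K a = 1"
    "x \<in> V \<Longrightarrow> x \<notin> K \<Longrightarrow> sol K x = 0"
    using K(2) by (auto simp: solves_dirichlet_def laplacian_eq_0_iff subset_iff)
qed

lemma sol_nonneg:
  assumes K: "finite K" "K \<subseteq> V" "a \<in> K" and "x \<in> V"
  shows "sol K x \<ge> 0"
proof (rule minimum_principle[of "K - {a}"])
  fix x assume "x \<in> V - (K - {a})"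
  then show "sol K x \<ge> 0"
    using sol_root[OF K] sol_outside[OF K, of x] by (cases "x = a") auto
qed (use assms sol_harmonic[OF K] in auto)

text \<open>Both solutions are harmonic on \<open>K - {a}\<close> because \<open>K\<close> lies in
  \<open>L\<close>. Their difference vanishes at \<open>a\<close>, and off \<open>K\<close> it is
  the nonnegative \<open>sol L\<close>, so the minimum principle applies.\<close>

lemma sol_mono:
  assumes K: "finite K" "K \<subseteq> V" "a \<in> K" and L: "finite L" "L \<subseteq> V" "K \<subseteq> L" and "x \<in> V"
  shows "sol K x \<le> sol L x"
proof -
  have aL: "a \<in> L" using K L by blast
  note L' = L(1,2) aL
  have "sol L x - sol K x \<ge> 0"
  proof (rule minimum_principle[of "K - {a}"])
    fix x assume "x \<in> V - (K - {a})"
    then show "sol L x - sol K x \<ge> 0"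
      using sol_root[OF K] sol_root[OF L'] sol_outside[OF K, of x] sol_nonneg[OF L', of x]
      by (cases "x = a") auto
  next
    fix x assume "x \<in> K - {a}"
    then show "flux V b (\<lambda>x. sol L x - sol K x) x \<ge> 0"
      using sol_harmonic[OF K, of x] sol_harmonic[OF L', of x] L(3) by (auto simp: flux_diff)
  qed (use assms in auto)
  then show ?thesis by simp
qed

lemma sol_le_1:
  assumes K: "finite K" "K \<subseteq> V" "a \<in> K" and "x \<in> V"
  shows "sol K x \<le> 1"
proof -
  have "1 - sol K x \<ge> 0"
  proof (rule minimum_principle[of "K - {a}"])
    fix x assume "x \<in> V - (K - {a})"
    then show "1 - sol K x \<ge> 0"
      using sol_root[OF K] sol_outside[OF K, of x] by (cases "x = a") auto
  qed (use assms sol_harmonic[OF K] in \<open>auto simp: flux_diff flux_const\<close>)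
  then show ?thesis by simp
qed

lemma cap_on_flux: "cap_on V b m K a = flux V b (sol K) a"
  using mass_pos[OF root] by (simp add: cap_on_def laplacian_flux)

lemma cap_on_conv_sum:
  assumes "finite K" "K \<subseteq> V" "a \<in> K"
  shows "cap_on V b m K a = weighted_degree V b a - (\<Sum>y\<in>nbrs V b a. sol K y * b a y)"
  by (simp add: cap_on_flux flux_conv_degree sol_root[OF assms])

lemma cap_on_nonneg:
  assumes K: "finite K" "K \<subseteq> V" "a \<in> K"
  shows "cap_on V b m K a \<ge> 0"
  unfolding cap_on_flux flux_def
  using sol_root[OF K] sol_le_1[OF K] weight_nonneg[OF root]
  by (intro sum_nonneg mult_nonneg_nonneg) (auto simp: nbrs_def)

text \<open>Enlarging the set does not lower the solution at the neighbours of \<open>a\<close>, and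
  these values enter the capacity with a minus sign.\<close>

lemma cap_on_antimono:
  assumes K: "finite K" "K \<subseteq> V" "a \<in> K" and L: "finite L" "L \<subseteq> V" "K \<subseteq> L"
  shows "cap_on V b m L a \<le> cap_on V b m K a"
proof -
  have aL: "a \<in> L" using K L by blast
  show ?thesis
    unfolding cap_on_conv_sum[OF K] cap_on_conv_sum[OF L(1,2) aL]
    using sol_mono[OF K L] weight_nonneg[OF root]
    by (intro diff_left_mono sum_mono mult_right_mono) (auto simp: nbrs_def)
qed

section \<open>Solutions are controlled by capacities\<close>

text \<open>A Harnack-type inequality: for \<open>w a = 0\<close> the term
  \<open>- flux V b w a\<close> is the weighted sum of \<open>w\<close> over the neighbours of
  \<open>a\<close>. Both \<open>C\<close> and \<open>F\<close> are fixed before \<open>w\<close>,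
  which makes the bound uniform; they are built edge by edge along a path from \<open>a\<close> to
  \<open>x\<close>, with \<open>F\<close> collecting the vertices before \<open>x\<close>.\<close>

lemma nonneg_harmonic_bound:
  assumes "x \<in> V"
  shows "\<exists>C F. C > 0 \<and> finite F \<and> F \<subseteq> V \<and>
    (\<forall>w. (\<forall>y\<in>V. w y \<ge> 0) \<longrightarrow> w a = 0 \<longrightarrow> (\<forall>y\<in>F - {a}. flux V b w y = 0) \<longrightarrow>
      w x \<le> C * - flux V b w a)"
proof -
  have "(a, x) \<in> (edges V b)\<^sup>*"
    using connected assms root unfolding connected_in_def by blast
  then show ?thesis
  proof (induction rule: rtrancl_induct)
    case base
    \<comment> \<open>At the start of the path the left side is 0 and the right side nonnegative, so
      any positive constant serves.\<close>
    have "w a \<le> 1 * - flux V b w a" if "\<forall>y\<in>V. w y \<ge> 0" "w a = 0" for w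
      unfolding flux_conv_degree using that weight_nonneg[OF root]
      by (auto simp: nbrs_def intro!: sum_nonneg)
    then show ?case by (intro exI[of _ 1] exI[of _ "{}"]) auto
  next
    case (step y z)
    from step.hyps(2) have y: "y \<in> V" and z: "z \<in> V" "z \<in> nbrs V b y" "b y z \<noteq> 0"
      by (auto simp: edges_def nbrs_def)
    then have byz: "b y z > 0" using weight_nonneg[of y z] by simp
    obtain C F where C: "C > 0" and F: "finite F" "F \<subseteq> V"
      and CF: "\<And>w. \<lbrakk>\<forall>y\<in>V. w y \<ge> 0; w a = 0; \<forall>y\<in>F - {a}. flux V b w y = 0\<rbrakk>
        \<Longrightarrow> w y \<le> C * - flux V b w a"
      using step.IH by blast
    \<comment> \<open>The balance at \<open>y\<close> bounds \<open>w z * b y z\<close> by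
      \<open>weighted_degree V b y * w y - flux V b w y\<close>. The bound on \<open>w y\<close>
      contributes the product with \<open>C\<close>; the summand 1 pays for the flux, which need not
      vanish when \<open>y = a\<close>.\<close>
    define D where "D = (weighted_degree V b y * C + 1) / b y z"
    have deg: "weighted_degree V b y \<ge> 0"
      unfolding weighted_degree_def using weight_nonneg[OF y] by (auto simp: nbrs_def intro!: sum_nonneg)
    have D: "D > 0"
      using C byz deg by (auto simp: D_def intro!: divide_pos_pos add_nonneg_pos)
    have "w z \<le> D * - flux V b w a"
      if w: "\<forall>y\<in>V. w y \<ge> 0" "w a = 0" "\<forall>y\<in>insert y F - {a}. flux V b w y = 0" for w
    proof -
      have fa: "- flux V b w a \<ge> 0"
        unfolding flux_conv_degree using w(1,2) weight_nonneg[OF root]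
        by (auto simp: nbrs_def intro!: sum_nonneg)
      have wy: "w y \<le> C * - flux V b w a" using CF w by simp
      have "w z * b y z \<le> (\<Sum>u\<in>nbrs V b y. w u * b y u)"
        using z w(1) weight_nonneg[OF y] finite_nbrs[OF y]
        by (intro member_le_sum) (auto simp: nbrs_def)
      also have "\<dots> = weighted_degree V b y * w y - flux V b w y"
        by (simp add: flux_conv_degree)
      also have "\<dots> \<le> weighted_degree V b y * (C * - flux V b w a) + - flux V b w a"
      \<comment> \<open>The path starts at \<open>a\<close> and may return there. Harmonicity fails
        to be given at \<open>a\<close>, but then \<open>w y = 0\<close> and the flux is the very
        term on the right.\<close>
      proof (cases "y = a")
        case True
        then have "w y = 0" "- flux V b w y = - flux V b w a" using w(2) by simp_all
        moreover have "weighted_degree V b y * (C * - flux V b w a) \<ge> 0"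
          using deg C fa by (intro mult_nonneg_nonneg) auto
        ultimately show ?thesis by simp
      next
        case False
        then have "flux V b w y = 0" using w(3) by simp
        then show ?thesis using mult_left_mono[OF wy deg] fa by linarith
      qed
      also have "\<dots> = D * - flux V b w a * b y z" using byz by (simp add: D_def field_simps)
      finally show ?thesis using byz by (rule mult_right_le_imp_le)
    qed
    then show ?case using D F y by (intro exI[of _ D] exI[of _ "insert y F"]) auto
  qed
qed

text \<open>The Harnack-type bound is applied to \<open>sol L - sol K\<close> and
  \<open>1 - sol K\<close>. Both are nonnegative, vanish at \<open>a\<close> and, once
  \<open>F\<close> lies in \<open>K\<close>, are harmonic on \<open>F - {a}\<close>; their fluxes
  into \<open>a\<close> are the capacity terms on the right.\<close>

lemma sol_bounds:
  assumes "x \<in> V"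
  shows "\<exists>C F. C > 0 \<and> finite F \<and> F \<subseteq> V \<and>
    (\<forall>K L. F \<subseteq> K \<longrightarrow> a \<in> K \<longrightarrow> K \<subseteq> L \<longrightarrow> L \<subseteq> V \<longrightarrow> finite L \<longrightarrow>
      sol L x - sol K x \<le> C * (cap_on V b m K a - cap_on V b m L a) \<and>
      1 - sol K x \<le> C * cap_on V b m K a)"
proof -
  obtain C F where C: "C > 0" and F: "finite F" "F \<subseteq> V"
    and CF: "\<And>w. \<lbrakk>\<forall>y\<in>V. w y \<ge> 0; w a = 0; \<forall>y\<in>F - {a}. flux V b w y = 0\<rbrakk>
        \<Longrightarrow> w x \<le> C * - flux V b w a"
    using nonneg_harmonic_bound[OF assms] by blast
  have "sol L x - sol K x \<le> C * (cap_on V b m K a - cap_on V b m L a) \<and>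
      1 - sol K x \<le> C * cap_on V b m K a"
    if "F \<subseteq> K" "a \<in> K" "K \<subseteq> L" "L \<subseteq> V" "finite L" for K L
  proof
    have K: "finite K" "K \<subseteq> V" "a \<in> K" and L: "finite L" "L \<subseteq> V" "a \<in> L"
      using that finite_subset by auto
    show "sol L x - sol K x \<le> C * (cap_on V b m K a - cap_on V b m L a)"
      using CF[of "\<lambda>x. sol L x - sol K x"] sol_mono[OF K L(1,2) that(3)] sol_root[OF K] sol_root[OF L]
        sol_harmonic[OF K] sol_harmonic[OF L] that(1,3)
      by (auto simp: flux_diff cap_on_flux subset_iff)
    show "1 - sol K x \<le> C * cap_on V b m K a"
      using CF[of "\<lambda>x. 1 - sol K x"] sol_le_1[OF K] sol_root[OF K] sol_harmonic[OF K] that(1)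
      by (auto simp: flux_diff flux_const cap_on_flux subset_iff)
  qed
  then show ?thesis using C F by blast
qed

section \<open>Balls and exhaustions\<close>

text \<open>Endpoints of walks of length \<open>n\<close>: by local finiteness each further edge
  offers finitely many choices.\<close>

lemma finite_sphere: "finite {x. (a, x) \<in> edges V b ^^ n}"
proof (induction n)
  case (Suc n)
  have "{x. (a, x) \<in> edges V b ^^ Suc n} \<subseteq> (\<Union>y\<in>{y. (a, y) \<in> edges V b ^^ n} \<inter> V. nbrs V b y)"
    by (auto simp: edges_def nbrs_def)
  moreover have "finite (\<Union>y\<in>{y. (a, y) \<in> edges V b ^^ n} \<inter> V. nbrs V b y)"
    using Suc finite_nbrs by auto
  ultimately show ?case by (rule finite_subset)
qed simp

lemma finite_graph_ball: "finite (graph_ball V b n a)"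
proof (rule finite_subset)
  show "graph_ball V b n a \<subseteq> (\<Union>k<n. {x. (a, x) \<in> edges V b ^^ k})"
  proof
    fix x assume x: "x \<in> graph_ball V b n a"
    then have "(a, x) \<in> (edges V b)\<^sup>*"
      using connected root unfolding connected_in_def graph_ball_def by blast
    then obtain k where "(a, x) \<in> edges V b ^^ k" by (auto dest: rtrancl_imp_relpow)
    \<comment> \<open>Connectedness has provided some walk, so the \<open>LEAST\<close> in
      \<open>graph_dist\<close> is attained.\<close>
    then have "(a, x) \<in> edges V b ^^ graph_dist V b a x"
      unfolding graph_dist_def by (rule LeastI)
    then show "x \<in> (\<Union>k<n. {x. (a, x) \<in> edges V b ^^ k})"
      using x by (auto simp: graph_ball_def)
  qed
qed (simp add: finite_sphere)

text \<open>The radius starts at 1, since the ball of radius 0 is empty and the comparison of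
  capacities requires \<open>a\<close> in every set.\<close>

lemma exhaustion_balls: "exhaustion V (\<lambda>n. graph_ball V b (Suc n) a)"
  unfolding exhaustion_def
proof (intro conjI allI)
  show "V = (\<Union>n. graph_ball V b (Suc n) a)"
    unfolding graph_ball_def by blast
qed (use finite_graph_ball in \<open>auto simp: graph_ball_def\<close>)

lemma root_in_ball: "a \<in> graph_ball V b (Suc n) a"
  using root by (simp add: graph_ball_def graph_dist_def Least_eq_0)

end

lemma exhaustion_finite: "exhaustion V K \<Longrightarrow> finite (K n)"
  by (simp add: exhaustion_def)

lemma exhaustion_subset: "exhaustion V K \<Longrightarrow> K n \<subseteq> V"
  unfolding exhaustion_def by blast

lemma exhaustion_mono: "exhaustion V K \<Longrightarrow> n \<le> p \<Longrightarrow> K n \<subseteq> K p"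
  unfolding exhaustion_def by (rule lift_Suc_mono_le[of K]) blast+

lemma exhaustion_absorbs:
  assumes "exhaustion V K" "finite F" "F \<subseteq> V"
  shows "\<exists>n. F \<subseteq> K n"
  using assms(2,3)
proof (induction F rule: finite_induct)
  case (insert x F)
  then obtain n p where "F \<subseteq> K n" "x \<in> K p" using assms(1) unfolding exhaustion_def by blast
  moreover have "K n \<subseteq> K (max n p)" "K p \<subseteq> K (max n p)"
    using exhaustion_mono[OF assms(1)] by simp_all
  ultimately show ?case by (intro exI[of _ "max n p"]) blast
qed simp

section \<open>Independence of the capacity from the exhaustion\<close>

context weighted_infinite_graph
begin

lemma cap_on_exhaustion_antimono:
  assumes K: "exhaustion V K" "\<And>n. a \<in> K n" and "n \<le> p"
  shows "cap_on V b m (K p) a \<le> cap_on V b m (K n) a"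
proof (rule cap_on_antimono)
  show "K n \<subseteq> K p" by (rule exhaustion_mono[OF K(1) \<open>n \<le> p\<close>])
qed (use K in \<open>simp_all add: exhaustion_finite exhaustion_subset\<close>)

lemma cap_on_exhaustions_comparable:
  assumes K: "exhaustion V K" "\<And>n. a \<in> K n" and L: "exhaustion V L" "\<And>n. a \<in> L n"
  shows "\<exists>p. cap_on V b m (K p) a \<le> cap_on V b m (L n) a"
proof -
  have Ln: "finite (L n)" "L n \<subseteq> V" using L(1) by (simp_all add: exhaustion_finite exhaustion_subset)
  then obtain p where "L n \<subseteq> K p" using exhaustion_absorbs[OF K(1)] by blast
  moreover have "finite (K p)" "K p \<subseteq> V"
    using K(1) by (simp_all add: exhaustion_finite exhaustion_subset)
  ultimately show ?thesis using cap_on_antimono[OF Ln L(2)] by blast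
qed

text \<open>Every finite set of one exhaustion is absorbed by some set of the other, so the two
  decreasing sequences of capacities interleave.\<close>

lemma cap_on_limit_exhaustion_indep:
  assumes K: "exhaustion V K" "\<And>n. a \<in> K n" and L: "exhaustion V L" "\<And>n. a \<in> L n"
    and "converges_to (\<lambda>n. cap_on V b m (K n) a) c"
  shows "converges_to (\<lambda>n. cap_on V b m (L n) a) c"
proof (rule converges_to_interleaved[OF assms(5)])
  fix n p :: nat assume "n \<le> p"
  then show "cap_on V b m (K p) a \<le> cap_on V b m (K n) a" "cap_on V b m (L p) a \<le> cap_on V b m (L n) a"
    using cap_on_exhaustion_antimono[OF K] cap_on_exhaustion_antimono[OF L] by blast+
qed (use cap_on_exhaustions_comparable[OF K L] cap_on_exhaustions_comparable[OF L K] in blast)+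

lemma has_capacity_iff:
  assumes K: "exhaustion V K" "\<And>n. a \<in> K n"
  shows "has_capacity V b m a c \<longleftrightarrow> converges_to (\<lambda>n. cap_on V b m (K n) a) c"
proof -
  have "has_capacity V b m a c \<longleftrightarrow> converges_to (\<lambda>n. cap_on V b m (graph_ball V b (Suc n) a) a) c"
    unfolding has_capacity_def cap_ball_def
    by (rule converges_to_Suc_iff[symmetric])
  then show ?thesis
    using cap_on_limit_exhaustion_indep[OF K exhaustion_balls root_in_ball]
      cap_on_limit_exhaustion_indep[OF exhaustion_balls root_in_ball K] by blast
qed

end

section \<open>The capacity and the pointwise limits of the Dirichlet solutions\<close>

theorem theorem4p6:
  fixes V :: "'v set"
    and b :: "'v \<Rightarrow> 'v \<Rightarrow> 'k::linordered_field"
    and m :: "'v \<Rightarrow> 'k"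
    and a :: 'v
    and K :: "nat \<Rightarrow> 'v set"
    and v :: "nat \<Rightarrow> 'v \<Rightarrow> 'k"
  assumes "non_archimedean TYPE('k)"
    and "cauchy_complete TYPE('k)"
    and "countable_cofinality TYPE('k)"
    and "graph_over V b m"
    and "infinite V"
    and "locally_finite V b"
    and "connected_in b V"
    and "a \<in> V"
    and "exhaustion V K"
    and "\<And>n. connected_in b (K n)"
    and "a \<in> K 0"
    and "\<And>n. v n = dirichlet_solution V b m (K n) a"
  shows
    "((\<exists>c. has_capacity V b m a c)
        \<or> has_limit (\<lambda>n. laplacian V b m (v n) a)
        \<or> has_limit (\<lambda>n. \<Sum>y\<in>nbrs V b a. v n y * b a y)
      \<longrightarrow> (\<exists>c l s. has_capacity V b m a c
             \<and> converges_to (\<lambda>n. laplacian V b m (v n) a) l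
             \<and> converges_to (\<lambda>n. \<Sum>y\<in>nbrs V b a. v n y * b a y) s
             \<and> c = m a * l \<and> m a * l = weighted_degree V b a - s))
     \<and> (has_capacity V b m a 0 \<longleftrightarrow> (\<forall>x\<in>V. converges_to (\<lambda>n. v n x) 1))
     \<and> ((\<exists>c. has_capacity V b m a c \<and> c > 0) \<longleftrightarrow>
          (\<forall>x\<in>V. has_limit (\<lambda>n. v n x)) \<and> (\<exists>x\<in>V. \<exists>l. converges_to (\<lambda>n. v n x) l \<and> l < 1))
     \<and> (\<not> (\<exists>c. has_capacity V b m a c) \<longleftrightarrow> (\<exists>x\<in>V. \<not> has_limit (\<lambda>n. v n x)))"
proof -
  have g: "\<And>x. x \<in> V \<Longrightarrow> m x > 0" "\<And>x y. x \<in> V \<Longrightarrow> y \<in> V \<Longrightarrow> b x y \<ge> 0"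
    using assms(4) by (auto simp: graph_over_def)
  interpret weighted_infinite_graph V b m a
    using g assms(5-8) by unfold_locales (auto simp: locally_finite_def)
  have aK: "a \<in> K n" for n
    using exhaustion_mono[OF assms(9), of 0 n] assms(11) by auto
  have Kn: "finite (K n)" "K n \<subseteq> V" "a \<in> K n" for n
    using assms(9) aK exhaustion_finite exhaustion_subset by metis+
  define r where "r n = cap_on V b m (K n) a" for n
  define s where "s n = (\<Sum>y\<in>nbrs V b a. v n y * b a y)" for n
  have hc: "has_capacity V b m a c \<longleftrightarrow> converges_to r c" for c
    unfolding r_def by (rule has_capacity_iff[OF assms(9) aK])
  have ma: "m a > 0" using g(1) root by blast
  \<comment> \<open>The capacities are a nonzero multiple of the Laplacians at \<open>a\<close> and
    a constant minus the neighbour sums, so the three sequences converge together.\<close>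
  have r_lap: "r = (\<lambda>n. m a * laplacian V b m (v n) a)"
    by (simp add: fun_eq_iff r_def cap_on_def assms(12) mult.commute)
  have r_sum: "r = (\<lambda>n. weighted_degree V b a - s n)"
    by (simp add: fun_eq_iff r_def s_def cap_on_conv_sum[OF Kn] assms(12))

  have lap_of_cap: "converges_to (\<lambda>n. laplacian V b m (v n) a) (c / m a)" if "converges_to r c" for c
    using converges_to_cmult[OF that, of "1 / m a"] ma by (simp add: r_lap)
  have sum_of_cap: "converges_to s (weighted_degree V b a - c)" if "converges_to r c" for c
    using converges_to_const_diff[OF that, of "weighted_degree V b a"] by (simp add: r_sum)
  have cap_of_lap: "converges_to r (m a * l)" if "converges_to (\<lambda>n. laplacian V b m (v n) a) l" for l
    using converges_to_cmult[OF that, of "m a"] by (simp add: r_lap)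
  have cap_of_sum: "converges_to r (weighted_degree V b a - l)" if "converges_to s l" for l
    using converges_to_const_diff[OF that, of "weighted_degree V b a"] by (simp add: r_sum)

  have formula: "\<exists>c l s'. has_capacity V b m a c \<and> converges_to (\<lambda>n. laplacian V b m (v n) a) l
      \<and> converges_to s s' \<and> c = m a * l \<and> m a * l = weighted_degree V b a - s'"
    if "converges_to r c" for c
    using lap_of_cap[OF that] sum_of_cap[OF that] that ma hc
    by (intro exI[of _ c] exI[of _ "c / m a"] exI[of _ "weighted_degree V b a - c"]) auto

  \<comment> \<open>\<open>N\<close> is an index at which the exhaustion has absorbed the finite set
    \<open>F\<close> belonging to \<open>x\<close>. Absolute values are harmless since the solutions
    increase with the set and are at most 1.\<close>
  have bounds: "\<exists>C N. C > 0 \<and> (\<forall>n\<ge>N. \<forall>p\<ge>n. \<bar>v p x - v n x\<bar> \<le> C * (r n - r p) \<and>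
      \<bar>v n x - 1\<bar> \<le> C * r n)" if x: "x \<in> V" for x
  proof -
    obtain C F where C: "C > 0" and F: "finite F" "F \<subseteq> V"
      and CF: "\<And>K L. \<lbrakk>F \<subseteq> K; a \<in> K; K \<subseteq> L; L \<subseteq> V; finite L\<rbrakk> \<Longrightarrow>
        sol L x - sol K x \<le> C * (cap_on V b m K a - cap_on V b m L a) \<and>
        1 - sol K x \<le> C * cap_on V b m K a"
      using sol_bounds[OF x] by blast
    obtain N where N: "F \<subseteq> K N" using exhaustion_absorbs[OF assms(9) F] by blast
    have "\<bar>v p x - v n x\<bar> \<le> C * (r n - r p) \<and> \<bar>v n x - 1\<bar> \<le> C * r n" if "n \<ge> N" "p \<ge> n" for n p
    proof -
      have "K N \<subseteq> K n" "K n \<subseteq> K p" using exhaustion_mono[OF assms(9)] that by auto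
      then have "sol (K p) x - sol (K n) x \<le> C * (r n - r p) \<and> 1 - sol (K n) x \<le> C * r n"
        unfolding r_def using N Kn by (intro CF) auto
      moreover have "sol (K n) x \<le> sol (K p) x"
        using Kn x \<open>K n \<subseteq> K p\<close> by (intro sol_mono) auto
      moreover have "sol (K n) x \<le> 1" using Kn x by (intro sol_le_1)
      ultimately show ?thesis by (simp add: assms(12))
    qed
    then show ?thesis using C by blast
  qed

  have limit_of_cap: "has_limit (\<lambda>n. v n x)" if "converges_to r c" "x \<in> V" for c x
  proof -
    have "has_limit r" using that(1) by (auto simp: has_limit_def)
    moreover obtain C N where "C > 0" "\<And>n p. N \<le> n \<Longrightarrow> n \<le> p \<Longrightarrow> \<bar>v p x - v n x\<bar> \<le> C * (r n - r p)"
      using bounds[OF \<open>x \<in> V\<close>] by blast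
    ultimately show ?thesis using has_limit_dominated[OF assms(2), of r N "\<lambda>n. v n x" C] by blast
  qed
  \<comment> \<open>The capacity sees \<open>v n\<close> only at the finitely many neighbours of
    \<open>a\<close>, so limits pass through the sum.\<close>
  have cap_of_limits: "converges_to r (weighted_degree V b a - (\<Sum>y\<in>nbrs V b a. l y * b a y))"
    if "\<And>x. x \<in> V \<Longrightarrow> converges_to (\<lambda>n. v n x) (l x)" for l
  proof (rule cap_of_sum)
    show "converges_to s (\<Sum>y\<in>nbrs V b a. l y * b a y)"
      unfolding s_def using that converges_to_cmult
      by (intro converges_to_sum) (fastforce simp: nbrs_def mult.commute)
  qed
  have cap_iff: "(\<exists>c. converges_to r c) \<longleftrightarrow> (\<forall>x\<in>V. has_limit (\<lambda>n. v n x))"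
  proof
    assume "\<forall>x\<in>V. has_limit (\<lambda>n. v n x)"
    then obtain l where "\<And>x. x \<in> V \<Longrightarrow> converges_to (\<lambda>n. v n x) (l x)"
      unfolding has_limit_def by metis
    then show "\<exists>c. converges_to r c" using cap_of_limits by blast
  qed (use limit_of_cap in blast)
  have zero_iff: "converges_to r 0 \<longleftrightarrow> (\<forall>x\<in>V. converges_to (\<lambda>n. v n x) 1)"
  proof
    assume r0: "converges_to r 0"
    show "\<forall>x\<in>V. converges_to (\<lambda>n. v n x) 1"
    proof
      fix x assume "x \<in> V"
      then obtain C N where "\<And>n. n \<ge> N \<Longrightarrow> \<bar>v n x - 1\<bar> \<le> C * r n" using bounds by blast
      \<comment> \<open>The bound \<open>C * r n\<close> tends to \<open>C * 0\<close>.\<close>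
      then show "converges_to (\<lambda>n. v n x) 1"
        using converges_to_squeeze converges_to_cmult[OF r0, of C] by fastforce
    qed
  next
    assume "\<forall>x\<in>V. converges_to (\<lambda>n. v n x) 1"
    \<comment> \<open>With all limits equal to 1 the neighbour sum tends to
      \<open>weighted_degree V b a\<close> and cancels the degree.\<close>
    then show "converges_to r 0"
      using cap_of_limits[of "\<lambda>_. 1"] by (simp add: weighted_degree_def)
  qed
  have lim_le_1: "l \<le> 1" if "x \<in> V" "converges_to (\<lambda>n. v n x) l" for x l
    using converges_to_nonneg[OF converges_to_const_diff[OF that(2), of 1]] sol_le_1[OF Kn that(1)]
    by (simp add: assms(12))
  have cap_nonneg: "c \<ge> 0" if "converges_to r c" for c
    using converges_to_nonneg[OF that] cap_on_nonneg[OF Kn] by (simp add: r_def)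

  have pos_iff: "(\<exists>c. converges_to r c \<and> c > 0) \<longleftrightarrow>
      (\<forall>x\<in>V. has_limit (\<lambda>n. v n x)) \<and> (\<exists>x\<in>V. \<exists>l. converges_to (\<lambda>n. v n x) l \<and> l < 1)"
  proof
    assume "\<exists>c. converges_to r c \<and> c > 0"
    then obtain c where c: "converges_to r c" "c > 0" by blast
    then have lims: "\<forall>x\<in>V. has_limit (\<lambda>n. v n x)" using cap_iff by blast
    \<comment> \<open>Uniqueness of limits excludes the limit 0. Hence at some \<open>x\<close> the
      limit is not 1, and being at most 1 it lies strictly below.\<close>
    have "\<not> converges_to r 0" using converges_to_unique c by blast
    then obtain x where x: "x \<in> V" "\<not> converges_to (\<lambda>n. v n x) 1" using zero_iff by blast
    then obtain l where l: "converges_to (\<lambda>n. v n x) l" using lims unfolding has_limit_def by blast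
    then have "l < 1" using lim_le_1[OF x(1) l] x(2) by (metis order_less_le)
    then show "(\<forall>x\<in>V. has_limit (\<lambda>n. v n x)) \<and> (\<exists>x\<in>V. \<exists>l. converges_to (\<lambda>n. v n x) l \<and> l < 1)"
      using lims x(1) l by blast
  next
    assume R: "(\<forall>x\<in>V. has_limit (\<lambda>n. v n x)) \<and> (\<exists>x\<in>V. \<exists>l. converges_to (\<lambda>n. v n x) l \<and> l < 1)"
    then obtain c where c: "converges_to r c" using cap_iff by blast
    \<comment> \<open>Capacity 0 would send every \<open>v n x\<close> to 1, against the vertex with
      a smaller limit; as \<open>c\<close> is nonnegative, it is then positive.\<close>
    have "c \<noteq> 0"
    proof
      assume "c = 0"
      then have "\<forall>x\<in>V. converges_to (\<lambda>n. v n x) 1" using c zero_iff by simp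
      then show False using R converges_to_unique by (metis order_less_irrefl)
    qed
    then show "\<exists>c. converges_to r c \<and> c > 0" using c cap_nonneg[OF c] by (metis order_less_le)
  qed

  have "(\<exists>c. has_capacity V b m a c) \<or> has_limit (\<lambda>n. laplacian V b m (v n) a) \<or> has_limit s
      \<longrightarrow> (\<exists>c. converges_to r c)"
    using hc cap_of_lap cap_of_sum unfolding has_limit_def by blast
  then have "(\<exists>c. has_capacity V b m a c) \<or> has_limit (\<lambda>n. laplacian V b m (v n) a) \<or> has_limit s
      \<longrightarrow> (\<exists>c l s'. has_capacity V b m a c \<and> converges_to (\<lambda>n. laplacian V b m (v n) a) l
        \<and> converges_to s s' \<and> c = m a * l \<and> m a * l = weighted_degree V b a - s')"
    using formula by blast
  moreover have "s = (\<lambda>n. \<Sum>y\<in>nbrs V b a. v n y * b a y)" by (simp add: s_def fun_eq_iff)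
  \<comment> \<open>The claim on nonexistence follows by negating both sides of
    \<open>cap_iff\<close>.\<close>
  ultimately show ?thesis
    using zero_iff pos_iff cap_iff by (simp add: hc)
qed

end
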